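(* Let $V_1\in\mathbb{C}[x_1,\dots,x_n]$ and $V_2\in\mathbb{C}[y_1,\dots,y_m]$ be potentials, and let $Q(x,y)$ be a (graded) rank $N$ orbifold equivalence between $V_1(x)$ and $V_2(y)$, i.e. $Q(x,y)$ is a graded rank $N$ matrix factorisation with $Q^2=(V_1(x)-V_2(y))\,\mathbf 1_{2N}$ and $q_L(Q)\,q_R(Q)\neq 0$. Set $Q_1(x):=Q(x,y)|_{y=0}$ and $F_j:=\partial_{y_j}Q(x,y)|_{y=0}$ for $j=1,\dots,m$. Then: (1) For every $j=1,\dots,m$, $F_j$ is a fermionic morphism of $Q_1$ with R-charge $R_j=1-|y_j|$. (2) The left quantum dimension of $Q$ can be written as $$q_L(Q)=\langle F_1\cdots F_m\rangle^{\mathrm{KapLi}}_{Q_1},$$ where $\langle\cdots\rangle^{\mathrm{KapLi}}_{Q_1}$ denotes the Kapustin–Li boundary correlator of the Landau–Ginzburg model with bulk potential $V_1$ and boundary condition (matrix factorisation of $V_1$) $Q_1$. (3) $Q(x,y)$ has a finite perturbation expansion, with the $y_j$ appearing as parameters: $$Q(x,y)=\sum_{\kappa=0}^{\kappa_{\max}}Q^{(\kappa)}(x,y),\qquad Q^{(0)}(x,y)=Q_1(x),\qquad Q^{(1)}(x,y)=\sum_{j=1}^m y_jF_j,$$ where $Q^{(\kappa)}$ is the part of $Q$ that is homogeneous of degree $\kappa$ in $y_1,\dots,y_m$ (each $y_j$ counted with degree $1$), and the higher order terms ($\kappa\ge2$) satisfy $$\{Q_1,Q^{(\kappa)}\}+\sum_{\lambda=1}^{\kappa-1}Q^{(\kappa-\lambda)}Q^{(\lambda)}=-V_2^{(\kappa)}\,\mathbf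 1_{2N},$$ where $\{\cdot,\cdot\}$ is the anti-commutator and $V_2^{(\kappa)}$ is the order $\kappa$ term of $V_2$, i.e. its degree-$\kappa$ part in $y$.
   Context: Potentials. A polynomial $W\in\mathbb{C}[z_1,\dots,z_k]$ is quasi-homogeneous if there are rational weights $|z_i|>0$ such that every monomial of $W$ has the same weight. A potential is a quasi-homogeneous polynomial of weight $2$ lying in $\mathfrak m^2$, $\mathfrak m=\langle z_1,\dots,z_k\rangle$, whose Jacobi ring $\mathbb{C}[z]/\langle\partial_{z_1}W,\dots,\partial_{z_k}W\rangle$ is finite-dimensional over $\mathbb{C}$. The variables of $V_1,V_2$ carry weights $|x_i|,|y_j|$. Graded matrix factorisations. A rank $N$ matrix factorisation of $W$ is $Q=\begin{pmatrix} 0 & E \\ J & 0 \end{pmatrix}$ with $E,J\in M_N(\mathbb{C}[z])$ and $EJ=JE=W\mathbf 1_N$, so $Q^2=W\mathbf 1_{2N}$. It is graded if there are $g_1,\dots,g_{2N}\in\mathbb{Q}$ such that, with $U(\lambda)=\mathrm{diag}(\lambda^{g_1},\dots,\lambda^{g_{2N}})$ and $\lambda\rhd z=(\lambda^{|z_1|}z_1,\dots,\lambda^{|z_k|}z_k)$, one has $U(\lambda)Q(\lambda\rhd z)U(\lambda)^{-1}=\lambda Q(z)$ for all $\lambda\in\mathbb{C}\setminus\{0\}$; equivalently each entry $Q_{rs}$ is quasi-homogeneous of weight $g_s-g_r+1$ (or zero). Matrix factorisations are assumed to have no non-zero constant entries. R-charge. A matrix $A\in M_{2N}(\mathbb{C}[z])$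 has R-charge $R$ with respect to the grading $U(\lambda)$ if $U(\lambda)A(\lambda\rhd z)U(\lambda)^{-1}=\lambda^RA(z)$. Here $Q_1(x)$ carries the same grading matrix $U(\lambda)$ as $Q(x,y)$. Morphisms. Let $\sigma=\mathrm{diag}(\mathbf 1_N,-\mathbf 1_N)$. A matrix is even (bosonic) if it commutes with $\sigma$ and odd (fermionic) if it anti-commutes with $\sigma$; $\mathrm{str}(A)=\mathrm{tr}(\sigma A)$. Morphisms of a matrix factorisation $Q$ are represented by elements of the kernel of $d_{QQ}(A)=QA-(-1)^{s(A)}AQ$, where $s(A)=0$ for even, $1$ for odd $A$ (taken modulo the image of $d_{QQ}$). So a fermionic morphism of $Q_1$ is represented by an odd matrix $F$ over $\mathbb{C}[x]$ with $Q_1F+FQ_1=0$. Residue. $\mathrm{res}_x\left[\frac{g}{f_1\cdots f_n}\right]$ is the Grothendieck residue at $0$ (normalised so that $\mathrm{res}_x[1/(x_1\cdots x_n)]=1$), extended $\mathbb{C}[y]$-linearly to $g\in\mathbb{C}[x,y]$; similarly $\mathrm{res}_y$. Kapustin–Li correlator. For a matrix factorisation $Q_1(x)$ of $V_1(x)$ and a matrix $\psi$ over $\mathbb{C}[x]$, $$\langle\psi\rangle^{\mathrm{KapLi}}_{Q_1}=\mathrm{res}_x\left[\frac{\mathrm{str}(\partial_{x_1}Q_1\cdots\partial_{x_n}Q_1\,\psi)}{\partial_{x_1}V_1\cdots\partial_{x_n}V_1}\right].$$ Orbifold equivalence. A graded matrix factorisation $Q(x,y)$ of $V_1(x)-V_2(y)$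 is an orbifold equivalence between $V_1$ and $V_2$ if both quantum dimensions $$q_L(Q)=(-1)^{\binom{m+1}{2}}\,\mathrm{res}_x\left[\frac{\mathrm{str}(\partial_{x_1}Q\cdots\partial_{x_n}Q\,\partial_{y_1}Q\cdots\partial_{y_m}Q)}{\partial_{x_1}V_1\cdots\partial_{x_n}V_1}\right],$$ $$q_R(Q)=(-1)^{\binom{n+1}{2}}\,\mathrm{res}_y\left[\frac{\mathrm{str}(\partial_{x_1}Q\cdots\partial_{x_n}Q\,\partial_{y_1}Q\cdots\partial_{y_m}Q)}{\partial_{y_1}V_2\cdots\partial_{y_m}V_2}\right]$$ are invertible, i.e. non-zero complex numbers. Convention in (3): $Q^{(\kappa)}=0$ for $\kappa>\kappa_{\max}$.
   Formalization: In (2) the formal identity is q_L(Q) = (-1)^{binom(m+1,2)} <F_1...F_m>; without this sign it fails for V_1=x^2, V_2=y^2, E=x-y, J=x+y, where q_L=-1 but the correlator of F_1 is 1. *)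

theory Defs
  imports "HOL-Analysis.Analysis" "HOL-Library.Poly_Mapping"
begin

section \<open>Polynomials\<close>

text \<open>
  Polynomials over the complex numbers in variables indexed by the finite type \<^typ>\<open>'v\<close>, with
  the convolution ring structure of Poly_Mapping.  The ring C[x] has variables indexed by a type
  'n, C[y] by a type 'm, and C[x,y] by the sum type 'n + 'm, so that x_i is
  \<open>Var (Inl i)\<close> and y_j is \<open>Var (Inr j)\<close> there.
\<close>

type_synonym 'v monom = "'v \<Rightarrow>\<^sub>0 nat"
type_synonym 'v cpoly = "('v \<Rightarrow>\<^sub>0 nat) \<Rightarrow>\<^sub>0 complex"

definition Const :: "complex \<Rightarrow> 'v cpoly" where
  "Const c = Poly_Mapping.single 0 c"

definition Var :: "'v \<Rightarrow> 'v cpoly" where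
  "Var i = Poly_Mapping.single (Poly_Mapping.single i 1) 1"

definition subst_poly :: "('v::finite \<Rightarrow> 'u cpoly) \<Rightarrow> 'v cpoly \<Rightarrow> 'u cpoly" where
  "subst_poly s p =
    (\<Sum>a\<in>Poly_Mapping.keys p.
      Const (Poly_Mapping.lookup p a) * (\<Prod>i\<in>UNIV. s i ^ Poly_Mapping.lookup a i))"

text \<open>Monomials without \<open>i\<close> are harmless below: they get the coefficient 0.\<close>

definition pdiff :: "'v \<Rightarrow> 'v cpoly \<Rightarrow> 'v cpoly" where
  "pdiff i p =
    (\<Sum>a\<in>Poly_Mapping.keys p.
      Poly_Mapping.single (a - Poly_Mapping.single i 1)
        (of_nat (Poly_Mapping.lookup a i) * Poly_Mapping.lookup p a))"

definition in_x :: "'n::finite cpoly \<Rightarrow> ('n + 'm) cpoly" where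
  "in_x = subst_poly (\<lambda>i. Var (Inl i))"

definition in_y :: "'m::finite cpoly \<Rightarrow> ('n + 'm) cpoly" where
  "in_y = subst_poly (\<lambda>j. Var (Inr j))"

definition at_y0 :: "('n::finite + 'm::finite) cpoly \<Rightarrow> 'n cpoly" where
  "at_y0 = subst_poly (case_sum Var (\<lambda>_. 0))"

definition y_part :: "nat \<Rightarrow> ('n + 'm::finite) cpoly \<Rightarrow> ('n + 'm) cpoly" where
  "y_part k p =
    (\<Sum>a\<in>{a \<in> Poly_Mapping.keys p. (\<Sum>j\<in>UNIV. Poly_Mapping.lookup a (Inr j)) = k}.
      Poly_Mapping.single a (Poly_Mapping.lookup p a))"


section \<open>Potentials\<close>

definition monom_weight :: "('v::finite \<Rightarrow> rat) \<Rightarrow> 'v monom \<Rightarrow> rat" where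
  "monom_weight w a = (\<Sum>i\<in>UNIV. of_nat (Poly_Mapping.lookup a i) * w i)"

definition quasi_homogeneous :: "('v::finite \<Rightarrow> rat) \<Rightarrow> rat \<Rightarrow> 'v cpoly \<Rightarrow> bool" where
  "quasi_homogeneous w d p \<longleftrightarrow> (\<forall>a\<in>Poly_Mapping.keys p. monom_weight w a = d)"

text \<open>An ideal is a submodule of the ring, so the generated ideal is the span for \<open>(*)\<close>.\<close>

definition ideal_of :: "'v cpoly set \<Rightarrow> 'v cpoly set" where
  "ideal_of S = module.span (*) S"

definition jacobi_ideal :: "'v cpoly \<Rightarrow> 'v cpoly set" where
  "jacobi_ideal W = ideal_of (range (\<lambda>i. pdiff i W))"

text \<open>The residue classes of finitely many polynomials span the Jacobi ring over C.\<close>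

definition jacobi_ring_finite_dim :: "'v cpoly \<Rightarrow> bool" where
  "jacobi_ring_finite_dim W \<longleftrightarrow>
    (\<exists>B. finite B \<and>
      (\<forall>p. \<exists>b \<in> module.span (\<lambda>c q. Const c * q) B. p - b \<in> jacobi_ideal W))"

definition potential :: "('v::finite \<Rightarrow> rat) \<Rightarrow> 'v cpoly \<Rightarrow> bool" where
  "potential w W \<longleftrightarrow>
    (\<forall>i. 0 < w i) \<and> quasi_homogeneous w 2 W \<and>
    W \<in> ideal_of {Var i * Var j |i j. True} \<and> jacobi_ring_finite_dim W"


section \<open>Graded matrix factorisations and their morphisms\<close>

text \<open>
  A 2N x 2N matrix is indexed by \<^typ>\<open>'N + 'N\<close>: \<open>Inl\<close> for the first N rows and columns, \<open>Inr\<close>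
  for the last N.
\<close>

type_synonym ('v, 'N) smat = "'v cpoly ^ ('N + 'N) ^ ('N + 'N)"

definition off_diag ::
  "'v cpoly ^ 'N ^ 'N \<Rightarrow> 'v cpoly ^ 'N ^ 'N \<Rightarrow> ('v, 'N::finite) smat" where
  "off_diag E J = (\<chi> r s. case (r, s) of
      (Inl a, Inr b) \<Rightarrow> E $ a $ b
    | (Inr a, Inl b) \<Rightarrow> J $ a $ b
    | _ \<Rightarrow> 0)"

definition matrix_factorisation :: "'v cpoly \<Rightarrow> ('v, 'N::finite) smat \<Rightarrow> bool" where
  "matrix_factorisation W Q \<longleftrightarrow>
    (\<exists>E J. Q = off_diag E J \<and> E ** J = mat W \<and> J ** E = mat W) \<and>
    (\<forall>r s c. Q $ r $ s = Const c \<longrightarrow> c = 0)"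

text \<open>
  Powers of \<open>l\<close> are taken with the principal branch of the logarithm; all of them are
  exponentials of rational multiples of the same \<open>Ln l\<close>, so exponents add up as usual.
\<close>

definition U_mat :: "('N \<Rightarrow> rat) \<Rightarrow> complex \<Rightarrow> 'v cpoly ^ 'N ^ 'N" where
  "U_mat g l = (\<chi> r s. if r = s then Const (l powr of_rat (g r)) else 0)"

definition rescale :: "('v::finite \<Rightarrow> rat) \<Rightarrow> complex \<Rightarrow> 'v cpoly \<Rightarrow> 'v cpoly" where
  "rescale w l = subst_poly (\<lambda>i. Const (l powr of_rat (w i)) * Var i)"

definition R_charge ::
  "('v::finite \<Rightarrow> rat) \<Rightarrow> ('N + 'N \<Rightarrow> rat) \<Rightarrow> rat \<Rightarrow> ('v, 'N::finite) smat \<Rightarrow> bool" where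
  "R_charge w g R A \<longleftrightarrow>
    (\<forall>l. l \<noteq> 0 \<longrightarrow>
      U_mat g l ** map_matrix (rescale w l) A ** matrix_inv (U_mat g l) =
        map_matrix ((*) (Const (l powr of_rat R))) A)"

definition graded_mf ::
  "('v::finite \<Rightarrow> rat) \<Rightarrow> ('N + 'N \<Rightarrow> rat) \<Rightarrow> 'v cpoly \<Rightarrow> ('v, 'N::finite) smat \<Rightarrow> bool" where
  "graded_mf w g W Q \<longleftrightarrow> matrix_factorisation W Q \<and> R_charge w g 1 Q"

definition sigma :: "('v, 'N::finite) smat" where
  "sigma = (\<chi> r s. if r = s then case_sum (\<lambda>_. 1) (\<lambda>_. - 1) r else 0)"

definition str :: "('v, 'N::finite) smat \<Rightarrow> 'v cpoly" where
  "str A = trace (sigma ** A)"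

definition fermionic :: "('v, 'N::finite) smat \<Rightarrow> bool" where
  "fermionic A \<longleftrightarrow> A ** sigma = - (sigma ** A)"

text \<open>Closedness under \<open>d_QQ(F) = QF - (-1)^s(F) FQ\<close> for \<open>s(F) = 1\<close>.\<close>

definition fermionic_morphism :: "('v, 'N::finite) smat \<Rightarrow> ('v, 'N) smat \<Rightarrow> bool" where
  "fermionic_morphism Q F \<longleftrightarrow> fermionic F \<and> Q ** F + F ** Q = 0"


section \<open>Residues\<close>

text \<open>
  The Grothendieck residue at 0 of \<open>g/(f_1 ... f_n)\<close>, via the transformation law: if
  \<open>x_i^(k_i+1) = \<Sum>j. A_ij f_j\<close> for all \<open>i\<close>, then it equals the residue of
  \<open>det A g / (x_1^(k_1+1) ... x_n^(k_n+1))\<close>, which is the coefficient of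
  \<open>x_1^k_1 ... x_n^k_n\<close> in \<open>det A g\<close>; \<open>f = Var\<close>, \<open>A = mat 1\<close>, \<open>k = 0\<close> is the normalisation.
  If 0 is the only common zero of the \<open>f_j\<close>, such \<open>k\<close> and \<open>A\<close> exist over the polynomial ring and
  the value does not depend on their choice.  The partial derivatives of a potential have only
  this common zero, since the Jacobi ideal is generated by quasi-homogeneous elements for positive
  weights and has finite codimension.
\<close>

definition residue0 :: "('n::finite \<Rightarrow> 'n cpoly) \<Rightarrow> 'n cpoly \<Rightarrow> complex" where
  "residue0 f g = (THE c. \<exists>(k :: 'n monom) (A :: 'n cpoly ^ 'n ^ 'n).
      (\<forall>i. Var i ^ (Poly_Mapping.lookup k i + 1) = (\<Sum>j\<in>UNIV. A $ i $ j * f j)) \<and>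
      c = Poly_Mapping.lookup (det A * g) k)"

text \<open>
  The extension of the residue to polynomials with further variables, linear over polynomials in
  those.  The injections \<open>u\<close> and \<open>v\<close> (in the applications, \<open>Inl\<close> and \<open>Inr\<close>) name the variables
  on which the residue acts and the remaining ones; \<open>map_key u a\<close> is the part of the monomial \<open>a\<close>
  in the former (\<open>lookup a \<circ> u\<close>, as \<open>u\<close> is injective).
\<close>

definition coeff_along ::
  "('a \<Rightarrow> 'w) \<Rightarrow> ('b \<Rightarrow> 'w) \<Rightarrow> 'b monom \<Rightarrow> 'w cpoly \<Rightarrow> 'a cpoly" where
  "coeff_along u v b p =
    (\<Sum>a\<in>{a \<in> Poly_Mapping.keys p. Poly_Mapping.map_key v a = b}.
      Poly_Mapping.single (Poly_Mapping.map_key u a) (Poly_Mapping.lookup p a))"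

definition residue_ext ::
  "('a::finite \<Rightarrow> 'w) \<Rightarrow> ('b \<Rightarrow> 'w) \<Rightarrow> ('a \<Rightarrow> 'a cpoly) \<Rightarrow> 'w cpoly \<Rightarrow> 'b cpoly" where
  "residue_ext u v f p =
    (\<Sum>b\<in>Poly_Mapping.map_key v ` Poly_Mapping.keys p.
      Poly_Mapping.single b (residue0 f (coeff_along u v b p)))"


section \<open>Correlators, quantum dimensions and orbifold equivalences\<close>

text \<open>The product over all indices, in increasing order of the index.\<close>

definition mat_prod ::
  "('i::{finite,linorder} \<Rightarrow> ('v, 'N::finite) smat) \<Rightarrow> ('v, 'N) smat" where
  "mat_prod M = foldr (\<lambda>i B. M i ** B) (sorted_list_of_set UNIV) (mat 1)"

definition kapustin_li ::
  "'n::{finite,linorder} cpoly \<Rightarrow> ('n, 'N::finite) smat \<Rightarrow> ('n, 'N) smat \<Rightarrow> complex" where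
  "kapustin_li V1 Q1 psi =
    residue0 (\<lambda>i. pdiff i V1) (str (mat_prod (\<lambda>i. map_matrix (pdiff i) Q1) ** psi))"

definition qdim_numerator ::
  "('n::{finite,linorder} + 'm::{finite,linorder}, 'N::finite) smat \<Rightarrow> ('n + 'm) cpoly" where
  "qdim_numerator Q =
    str (mat_prod (\<lambda>i. map_matrix (pdiff (Inl i)) Q) ** mat_prod (\<lambda>j. map_matrix (pdiff (Inr j)) Q))"

text \<open>
  A priori the quantum dimensions are polynomials in the variables that are not integrated.
  The sign in \<open>q_L\<close> is not part of \<^const>\<open>kapustin_li\<close>: for \<open>V1 = x^2\<close>, \<open>V2 = y^2\<close>, \<open>E = x - y\<close>,
  \<open>J = x + y\<close> the supertrace is 2, so \<open>q_L = -1\<close>, whereas the correlator of \<open>F_1\<close> is 1.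
\<close>

definition q_L ::
  "'n::{finite,linorder} cpoly \<Rightarrow> ('n + 'm::{finite,linorder}, 'N::finite) smat \<Rightarrow> 'm cpoly" where
  "q_L V1 Q =
    (- 1) ^ ((CARD('m) + 1) choose 2) *
      residue_ext Inl Inr (\<lambda>i. pdiff i V1) (qdim_numerator Q)"

definition q_R ::
  "'m::{finite,linorder} cpoly \<Rightarrow> ('n::{finite,linorder} + 'm, 'N::finite) smat \<Rightarrow> 'n cpoly" where
  "q_R V2 Q =
    (- 1) ^ ((CARD('n) + 1) choose 2) *
      residue_ext Inr Inl (\<lambda>j. pdiff j V2) (qdim_numerator Q)"

definition orbifold_equivalence ::
  "('n \<Rightarrow> rat) \<Rightarrow> ('m \<Rightarrow> rat) \<Rightarrow> ('N + 'N \<Rightarrow> rat) \<Rightarrow>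
   'n::{finite,linorder} cpoly \<Rightarrow> 'm::{finite,linorder} cpoly \<Rightarrow>
   ('n + 'm, 'N::finite) smat \<Rightarrow> bool" where
  "orbifold_equivalence wx wy g V1 V2 Q \<longleftrightarrow>
    graded_mf (case_sum wx wy) g (in_x V1 - in_y V2) Q \<and>
    (\<exists>c. c \<noteq> 0 \<and> q_L V1 Q = Const c) \<and> (\<exists>c. c \<noteq> 0 \<and> q_R V2 Q = Const c)"

end

theory Submission
  imports Defs
begin

text \<open>
  Setting \<open>y = 0\<close> is a ring homomorphism that commutes with the derivatives in \<open>x\<close>, so
  \<open>Q\<^sup>2 = V1 - V2\<close> and its derivative by \<open>y_j\<close> give \<open>Q1\<^sup>2 = V1\<close> and \<open>Q1 F_j + F_j Q1 = 0\<close>;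
  here \<open>V2\<close> has no linear terms because it lies in the square of the maximal ideal.  The parts of
  degree \<open>k\<close> in \<open>y\<close> of \<open>Q\<^sup>2 = V1 - V2\<close> are the equations of the perturbation expansion.  R-charge means
  that the entries are quasi-homogeneous, and a derivative by \<open>y_j\<close> lowers the weight by that of
  \<open>y_j\<close>.  Finally, \<open>q_L\<close> is a constant, so it may be evaluated at \<open>y = 0\<close>.
\<close>

section \<open>Operators on monomials\<close>

text \<open>Updating at a fresh exponent amounts to adding a monomial. Identities between maps that
  are additive in the polynomial thus reduce to single monomials.\<close>

lemma cpoly_induct [case_names monom add]:
  fixes p :: "'v cpoly"
  assumes "\<And>a c. P (Poly_Mapping.single a c)"
    and "\<And>p q. P p \<Longrightarrow> P q \<Longrightarrow> P (p + q)"
  shows "P p"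
proof (induct p rule: update_induct)
  case const
  show ?case using assms(1)[of 0 0] by simp
next
  case (update f a b)
  have "Poly_Mapping.update a b f = f + Poly_Mapping.single a b"
    using update(1) by (intro poly_mapping_eqI)
      (auto simp: lookup_update lookup_add lookup_single in_keys_iff)
  then show ?case using assms update by simp
qed

text \<open>Substitution and differentiation are both sums of this shape. Additivity of
  \<open>t a\<close> forces \<open>t a 0 = 0\<close>, so exponents that cancel in a sum of
  polynomials do no harm.\<close>

lemma additive_keys_sum:
  fixes t :: "'a \<Rightarrow> 'c::ab_group_add \<Rightarrow> 'b::ab_group_add"
  assumes "\<And>a x y. t a (x + y) = t a x + t a y"
  shows "Modules.additive (\<lambda>p. \<Sum>a\<in>Poly_Mapping.keys p. t a (Poly_Mapping.lookup p a))"
proof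
  have "t a 0 = 0" for a using assms[of a 0 0] by simp
  then show "(\<Sum>a\<in>Poly_Mapping.keys (p + q). t a (Poly_Mapping.lookup (p + q) a)) =
      (\<Sum>a\<in>Poly_Mapping.keys p. t a (Poly_Mapping.lookup p a)) +
      (\<Sum>a\<in>Poly_Mapping.keys q. t a (Poly_Mapping.lookup q a))" for p q
    using assms by (intro setsum_keys_plus_distrib)
qed

section \<open>Constants, variables and monomials\<close>

lemma Const_0 [simp]: "Const 0 = 0"
  and Const_1 [simp]: "Const 1 = 1"
  and Const_add: "Const (c + d) = Const c + Const d"
  and Const_minus: "Const (- c) = - Const c"
  and Const_mult: "Const (c * d) = Const c * Const d"
  by (simp_all add: Const_def single_add mult_single single_uminus)

lemma Const_power: "Const (c ^ n) = Const c ^ n"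
  by (induct n) (simp_all add: Const_mult)

lemma Const_prod: "Const (prod f A) = (\<Prod>i\<in>A. Const (f i))"
  by (induct A rule: infinite_finite_induct) (simp_all add: Const_mult)

lemma lookup_Const_mult:
  "Poly_Mapping.lookup (Const c * p) a = c * Poly_Mapping.lookup p a"
  by (induct p rule: cpoly_induct)
    (simp_all add: Const_def mult_single lookup_single when_def lookup_add distrib_left)

lemma lookup_mult_Const:
  "Poly_Mapping.lookup (p * Const c) a = Poly_Mapping.lookup p a * c"
  using lookup_Const_mult[of c p a] by (simp add: mult.commute)

lemma Var_power: "Var i ^ n = Poly_Mapping.single (Poly_Mapping.single i n) 1"
  by (induct n) (simp_all add: Var_def mult_single flip: single_add)

lemma prod_single:
  "(\<Prod>i\<in>A. Poly_Mapping.single (f i :: 'v monom) (1 :: complex)) = Poly_Mapping.single (\<Sum>i\<in>A. f i) 1"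
  by (induct A rule: infinite_finite_induct) (simp_all add: mult_single)

lemma sum_single_lookup:
  fixes a :: "'v::finite monom"
  shows "(\<Sum>i\<in>UNIV. Poly_Mapping.single i (Poly_Mapping.lookup a i)) = a"
  by (intro poly_mapping_eqI) (simp add: lookup_sum lookup_single when_def)

lemma prod_Var_power:
  "(\<Prod>i\<in>UNIV. Var i ^ Poly_Mapping.lookup a i) = Poly_Mapping.single (a :: 'v::finite monom) 1"
  by (simp add: Var_power prod_single sum_single_lookup)

section \<open>Substitution as a ring homomorphism\<close>

lemma additive_subst_poly: "Modules.additive (subst_poly s)"
  unfolding subst_poly_def by (rule additive_keys_sum) (simp add: Const_add distrib_right)

lemmas subst_poly_add = Modules.additive.add[OF additive_subst_poly]

lemma subst_poly_single:
  "subst_poly s (Poly_Mapping.single a c) = Const c * (\<Prod>i\<in>UNIV. s i ^ Poly_Mapping.lookup a i)"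
  by (simp add: subst_poly_def)

lemma subst_poly_mult: "subst_poly s (p * q) = subst_poly s p * subst_poly s q"
proof (induct p rule: cpoly_induct)
  case (monom a c)
  show ?case
    by (induct q rule: cpoly_induct)
      (simp_all add: mult_single subst_poly_single Const_mult lookup_add power_add
        prod.distrib subst_poly_add distrib_left distrib_right mult_ac)
qed (simp add: distrib_right subst_poly_add)

lemma subst_poly_1: "subst_poly s 1 = 1"
  using subst_poly_single[of s 0 1] by simp

lemma subst_poly_Var: "subst_poly s (Var i) = s i"
proof -
  have "(\<Prod>k\<in>UNIV. s k ^ Poly_Mapping.lookup (Poly_Mapping.single i 1) k) = (\<Prod>k\<in>UNIV. if k = i then s k else 1)"
    by (rule prod.cong) (auto simp: lookup_single when_def)
  then show ?thesis by (simp add: Var_def subst_poly_single)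
qed

lemma subst_poly_Var_single:
  "subst_poly (\<lambda>i. Var (u i)) (Poly_Mapping.single a c) =
    Poly_Mapping.single (\<Sum>i\<in>UNIV. Poly_Mapping.single (u i) (Poly_Mapping.lookup a i)) c"
  by (simp add: subst_poly_single Var_power prod_single Const_def mult_single)

section \<open>Partial derivatives\<close>

lemma additive_pdiff: "Modules.additive (pdiff i)"
  unfolding pdiff_def by (rule additive_keys_sum) (simp add: single_add distrib_left)

lemmas pdiff_add = Modules.additive.add[OF additive_pdiff]

lemma pdiff_single:
  "pdiff i (Poly_Mapping.single a c) =
    Poly_Mapping.single (a - Poly_Mapping.single i 1) (of_nat (Poly_Mapping.lookup a i) * c)"
  by (simp add: pdiff_def)

text \<open>Subtraction of exponents is truncated; it can be moved past an addition when the
  exponent lowered is positive.\<close>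

lemma monom_diff_add:
  assumes "Poly_Mapping.lookup a i \<noteq> (0::nat)"
  shows "a - Poly_Mapping.single i 1 + b = a + b - Poly_Mapping.single i 1"
  using assms by (intro poly_mapping_eqI) (auto simp: lookup_add lookup_minus lookup_single when_def)

lemma pdiff_mult: "pdiff i (p * q) = pdiff i p * q + p * pdiff i q"
proof (induct p rule: cpoly_induct)
  case (monom a c)
  show ?case
  proof (induct q rule: cpoly_induct)
    case (monom b d)
    show ?case
      \<comment> \<open>Where an exponent of \<open>i\<close> is 0, the truncated subtraction gives
        a wrong monomial, but its coefficient is 0.\<close>
      using monom_diff_add[of a i b] monom_diff_add[of b i a]
      by (cases "Poly_Mapping.lookup a i = 0"; cases "Poly_Mapping.lookup b i = 0")
        (simp_all add: mult_single pdiff_single lookup_add add.commute distrib_left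
          distrib_right mult_ac single_add)
  qed (simp add: distrib_left pdiff_add)
qed (simp add: distrib_right pdiff_add)

section \<open>The grading of C[x,y] by the degree in y\<close>

definition y_degree :: "('n + 'm::finite) monom \<Rightarrow> nat" where
  "y_degree a = (\<Sum>j\<in>UNIV. Poly_Mapping.lookup a (Inr j))"

lemma y_degree_add: "y_degree (a + b) = y_degree a + y_degree b"
  by (simp add: y_degree_def lookup_add sum.distrib)

lemma inj_Inl_Inr: "inj Inl" "inj Inr"
  by (simp_all add: inj_def)

lemma y_degree_eq_0_iff: "y_degree a = 0 \<longleftrightarrow> Poly_Mapping.map_key Inr a = 0"
  by (simp add: y_degree_def poly_mapping_eq_iff fun_eq_iff map_key.rep_eq inj_Inl_Inr)

lemma lookup_y_part:
  "Poly_Mapping.lookup (y_part k p) a = (Poly_Mapping.lookup p a when y_degree a = k)"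
  unfolding y_part_def y_degree_def[symmetric]
  by (auto simp: lookup_sum lookup_single when_def in_keys_iff intro: sum.neutral)

lemma additive_y_part: "Modules.additive (y_part k)"
  by standard (intro poly_mapping_eqI, simp add: lookup_y_part lookup_add when_add_distrib)

lemmas y_part_add = Modules.additive.add[OF additive_y_part]

lemma y_part_single:
  "y_part k (Poly_Mapping.single a c) = (if y_degree a = k then Poly_Mapping.single a c else 0)"
  by (intro poly_mapping_eqI) (auto simp: lookup_y_part lookup_single when_def)

lemma y_part_mult: "y_part k (p * q) = (\<Sum>l\<le>k. y_part (k - l) p * y_part l q)"
proof (induct p rule: cpoly_induct)
  case (monom a c)
  show ?case
  proof (induct q rule: cpoly_induct)
    case (monom b d)
    \<comment> \<open>For two monomials at most one term of the convolution survives: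
      \<open>l\<close> has to be the degree of the second one.\<close>
    have "(\<Sum>l\<le>k. y_part (k - l) (Poly_Mapping.single a c) * y_part l (Poly_Mapping.single b d)) =
      (\<Sum>l\<le>k. if l = y_degree b then (if y_degree a = k - l then Poly_Mapping.single (a + b) (c * d) else 0) else 0)"
      by (rule sum.cong) (auto simp: y_part_single mult_single)
    then show ?case
      by (auto simp: mult_single y_part_single y_degree_add)
  qed (simp add: distrib_left y_part_add sum.distrib)
qed (simp add: distrib_right y_part_add sum.distrib)


section \<open>Setting the second group of variables to zero\<close>

text \<open>The product over all variables splits into the x-part, which rebuilds the monomial, and
  a product of powers of 0. As \<open>0 ^ 0 = 1\<close>, the latter indicates whether the monomial
  is free of y.\<close>

lemma at_y0_single:
  fixes a :: "('n::finite + 'm::finite) monom"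
  shows "at_y0 (Poly_Mapping.single a c) =
    (if Poly_Mapping.map_key Inr a = 0 then Poly_Mapping.single (Poly_Mapping.map_key Inl a) c else 0)"
proof -
  have "(\<Prod>k\<in>UNIV. case_sum Var (\<lambda>_. 0) k ^ Poly_Mapping.lookup a k) =
      (\<Prod>i\<in>UNIV. Var i ^ Poly_Mapping.lookup (Poly_Mapping.map_key Inl a) i) *
      (\<Prod>j\<in>UNIV. 0 ^ Poly_Mapping.lookup (Poly_Mapping.map_key Inr a) j)"
    unfolding UNIV_Plus_UNIV[symmetric] by (subst prod.Plus) (simp_all add: map_key.rep_eq inj_Inl_Inr)
  moreover have "(\<Prod>j\<in>UNIV. (0::'n cpoly) ^ Poly_Mapping.lookup b j) = (if b = 0 then 1 else 0)"
    for b :: "'m monom"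
  proof (cases "b = 0")
    case False
    then obtain j where "Poly_Mapping.lookup b j \<noteq> 0"
      by (auto simp: poly_mapping_eq_iff fun_eq_iff)
    then show ?thesis
      using False by (auto simp: power_0_left intro!: prod_zero exI[of _ j])
  qed simp
  ultimately show ?thesis
    by (simp add: at_y0_def subst_poly_single prod_Var_power Const_def mult_single)
qed

lemma additive_at_y0: "Modules.additive at_y0"
  unfolding at_y0_def by (rule additive_subst_poly)

lemmas at_y0_add = Modules.additive.add[OF additive_at_y0]

lemma at_y0_mult: "at_y0 (p * q) = at_y0 p * at_y0 q"
  by (simp add: at_y0_def subst_poly_mult)

text \<open>Bridge to the residues: the slice of the numerator that determines the constant term of
  the extended residue is its value at y = 0.\<close>

lemma at_y0_eq_coeff_along: "at_y0 p = coeff_along Inl Inr 0 p"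
proof -
  have "at_y0 p = (\<Sum>a\<in>Poly_Mapping.keys p. at_y0 (Poly_Mapping.single a (Poly_Mapping.lookup p a)))"
    unfolding at_y0_def by (simp add: subst_poly_single) (simp add: subst_poly_def)
  also have "\<dots> = coeff_along Inl Inr 0 p"
    by (simp add: at_y0_single coeff_along_def sum.If_cases Int_def)
  finally show ?thesis .
qed

text \<open>Serves to trace a constant entry of \<open>Q1\<close> back to \<open>Q\<close>: a
  monomial whose x-part and y-part are both trivial is trivial.\<close>

lemma lookup_at_y0_0: "Poly_Mapping.lookup (at_y0 p) 0 = Poly_Mapping.lookup p 0"
proof (induct p rule: cpoly_induct)
  case (monom a c)
  have "a = 0" if "Poly_Mapping.map_key Inl a = 0" "Poly_Mapping.map_key Inr a = 0"
  proof (rule poly_mapping_eqI)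
    show "Poly_Mapping.lookup a k = Poly_Mapping.lookup 0 k" for k
      using that by (cases k) (simp_all add: poly_mapping_eq_iff fun_eq_iff map_key.rep_eq inj_Inl_Inr)
  qed
  then show ?case
    by (auto simp: at_y0_single lookup_single when_def)
qed (simp add: at_y0_add lookup_add)

text \<open>Lowering an x-exponent leaves the y-part of a monomial alone, so the same monomials
  survive on both sides.\<close>

lemma at_y0_pdiff: "at_y0 (pdiff (Inl i) p) = pdiff i (at_y0 p)"
proof (induct p rule: cpoly_induct)
  case (monom a c)
  have "Poly_Mapping.map_key Inr (a - Poly_Mapping.single (Inl i) 1) = Poly_Mapping.map_key Inr a"
    "Poly_Mapping.map_key Inl (a - Poly_Mapping.single (Inl i) 1) =
      Poly_Mapping.map_key Inl a - Poly_Mapping.single i 1"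
    by (intro poly_mapping_eqI, simp add: map_key.rep_eq inj_Inl_Inr lookup_minus lookup_single when_def)+
  then show ?case
    by (simp add: at_y0_single pdiff_single map_key.rep_eq inj_Inl_Inr Modules.additive.zero[OF additive_pdiff])
qed (simp add: at_y0_add pdiff_add)

section \<open>The embeddings of C[x] and C[y] into C[x,y]\<close>

lemma additive_in_x: "Modules.additive in_x" and additive_in_y: "Modules.additive in_y"
  unfolding in_x_def in_y_def by (rule additive_subst_poly)+

lemmas in_x_add = Modules.additive.add[OF additive_in_x]
lemmas in_y_add = Modules.additive.add[OF additive_in_y]

lemma in_x_single:
  "in_x (Poly_Mapping.single a c) =
    Poly_Mapping.single (\<Sum>i\<in>UNIV. Poly_Mapping.single (Inl i) (Poly_Mapping.lookup a i)) c"
  unfolding in_x_def by (rule subst_poly_Var_single)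

lemma lookup_sum_single_Inl:
  fixes f :: "'n::finite \<Rightarrow> nat"
  shows "Poly_Mapping.lookup (\<Sum>i\<in>UNIV. Poly_Mapping.single (Inl i) (f i)) (Inl k) = f k"
    and "Poly_Mapping.lookup (\<Sum>i\<in>UNIV. Poly_Mapping.single (Inl i) (f i)) (Inr j) = 0"
  by (simp_all add: lookup_sum lookup_single when_def)

lemma in_x_at_y0: "in_x (at_y0 p) = y_part 0 p"
proof (induct p rule: cpoly_induct)
  case (monom a c)
  have "(\<Sum>i\<in>UNIV. Poly_Mapping.single (Inl i) (Poly_Mapping.lookup (Poly_Mapping.map_key Inl a) i)) = a"
    if "Poly_Mapping.map_key Inr a = 0"
  proof (rule poly_mapping_eqI)
    fix k
    show "Poly_Mapping.lookup (\<Sum>i\<in>UNIV. Poly_Mapping.single (Inl i)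
        (Poly_Mapping.lookup (Poly_Mapping.map_key Inl a) i)) k = Poly_Mapping.lookup a k"
      using that by (cases k) (simp_all add: lookup_sum_single_Inl poly_mapping_eq_iff fun_eq_iff
          map_key.rep_eq inj_Inl_Inr)
  qed
  then show ?case
    by (simp add: at_y0_single in_x_single y_part_single y_degree_eq_0_iff Modules.additive.zero[OF additive_in_x])
qed (simp add: at_y0_add in_x_add y_part_add)

lemma at_y0_in_x: "at_y0 (in_x p :: ('n::finite + 'm::finite) cpoly) = p"
proof (induct p rule: cpoly_induct)
  case (monom a c)
  let ?b = "\<Sum>i\<in>UNIV. Poly_Mapping.single (Inl i) (Poly_Mapping.lookup a i) :: ('n + 'm) monom"
  have "Poly_Mapping.map_key Inr ?b = 0" "Poly_Mapping.map_key Inl ?b = a"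
    by (intro poly_mapping_eqI, simp add: map_key.rep_eq inj_Inl_Inr lookup_sum_single_Inl)+
  then show ?case
    by (simp add: at_y0_single in_x_single)
qed (simp add: at_y0_add in_x_add)

lemma y_part_in_x:
  fixes p :: "'n::finite cpoly"
  defines "q \<equiv> in_x p :: ('n + 'm::finite) cpoly"
  shows "y_part k q = (if k = 0 then q else 0)"
proof -
  have *: "y_part 0 q = q"
    using in_x_at_y0[of q] by (simp add: q_def at_y0_in_x)
  have "y_part k (y_part 0 q) = 0" if "k \<noteq> 0"
    using that by (intro poly_mapping_eqI) (auto simp: lookup_y_part when_def)
  then show ?thesis using * by simp
qed

lemma pdiff_Inr_in_x: "pdiff (Inr j) (in_x p) = 0"
  by (induct p rule: cpoly_induct)
    (simp_all add: in_x_single pdiff_single lookup_sum_single_Inl in_x_add pdiff_add)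

text \<open>Euler's identity in the variables y, restricted to degree 1: each \<open>j\<close>
  contributes the monomial multiplied by its exponent of \<open>y_j\<close>, and these exponents add
  up to 1.\<close>

lemma y_part_1: "y_part 1 p = (\<Sum>j\<in>UNIV. Var (Inr j) * in_x (at_y0 (pdiff (Inr j) p)))"
  unfolding in_x_at_y0
proof (induct p rule: cpoly_induct)
  case (monom a c)
  have *: "Var (Inr j) * y_part 0 (pdiff (Inr j) (Poly_Mapping.single a c)) =
      (if y_degree a = 1 then Poly_Mapping.single a (of_nat (Poly_Mapping.lookup a (Inr j)) * c) else 0)"
    for j
  proof (cases "Poly_Mapping.lookup a (Inr j) = 0")
    case True
    then show ?thesis by (simp add: pdiff_single Modules.additive.zero[OF additive_y_part])
  next
    case False
    \<comment> \<open>Multiplication by \<open>y_j\<close> undoes the derivative's lowering of the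
      exponent, and the degree in y goes up from 0 to 1.\<close>
    have a: "Poly_Mapping.single (Inr j) 1 + (a - Poly_Mapping.single (Inr j) 1) = a"
      using False by (intro poly_mapping_eqI) (auto simp: lookup_add lookup_minus lookup_single when_def)
    have "y_degree (Poly_Mapping.single (Inr j) 1 :: ('a + 'b) monom) = 1"
      by (simp add: y_degree_def lookup_single when_def)
    then have "y_degree a = 1 + y_degree (a - Poly_Mapping.single (Inr j) 1)"
      using y_degree_add a by metis
    then show ?thesis
      using a by (simp add: Var_def pdiff_single y_part_single mult_single)
  qed
  have "(\<Sum>j\<in>UNIV. Poly_Mapping.single a (of_nat (Poly_Mapping.lookup a (Inr j)) * c)) =
      Poly_Mapping.single a (of_nat (y_degree a) * c)"
    unfolding y_degree_def of_nat_sum sum_distrib_right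
    by (induct rule: infinite_finite_induct) (simp_all add: single_add)
  then show ?case
    unfolding * by (simp add: y_part_single)
qed (simp add: pdiff_add y_part_add distrib_left sum.distrib)

lemma module_mult: "module ((*) :: 'a::comm_ring_1 \<Rightarrow> _)"
  by unfold_locales (simp_all add: algebra_simps)

text \<open>By the Leibniz rule, the polynomials that vanish at y = 0 together with their derivative
  by \<open>y_k\<close> form an ideal, and it contains every product of two variables.\<close>

lemma at_y0_in_y_ideal_square:
  fixes p :: "'m::finite cpoly"
  assumes "p \<in> ideal_of {Var i * Var j |i j. True}"
  shows "at_y0 (in_y p :: ('n::finite + 'm) cpoly) = 0 \<and>
    at_y0 (pdiff (Inr k) (in_y p :: ('n + 'm) cpoly)) = 0"
  using assms unfolding ideal_of_def
proof (induct rule: module.span_induct[OF module_mult, consumes 1])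
  case 1
  note zero = Modules.additive.zero[OF additive_in_y] Modules.additive.zero[OF additive_at_y0]
    Modules.additive.zero[OF additive_pdiff]
  have "(in_y (p * q) :: ('n + 'm) cpoly) = in_y p * in_y q" for p q
    by (simp add: in_y_def subst_poly_mult)
  then show ?case
    unfolding module.subspace_def[OF module_mult]
    by (auto simp: zero in_y_add at_y0_add pdiff_add at_y0_mult pdiff_mult)
next
  case (2 x)
  have "at_y0 (Var (Inr j) :: ('n + 'm) cpoly) = 0" for j
    by (simp add: at_y0_def subst_poly_Var)
  with 2 show ?case
    by (auto simp: in_y_def subst_poly_mult subst_poly_Var at_y0_mult pdiff_mult at_y0_add)
qed


lemma sum_UNIV_Plus:
  fixes f :: "'a::finite + 'b::finite \<Rightarrow> 'c::comm_monoid_add"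
  shows "sum f UNIV = (\<Sum>a\<in>UNIV. f (Inl a)) + (\<Sum>b\<in>UNIV. f (Inr b))"
  unfolding UNIV_Plus_UNIV[symmetric] by (subst sum.Plus) simp_all


section \<open>Matrices\<close>

lemma map_matrix_mult:
  fixes h :: "'a::comm_ring_1 \<Rightarrow> 'b::comm_ring_1"
  assumes "Modules.additive h" and "\<And>x y. h (x * y) = h x * h y"
  shows "map_matrix h (A ** B) = map_matrix h A ** map_matrix h B"
  using assms by (simp add: vec_eq_iff matrix_matrix_mult_def Modules.additive.sum)

lemma map_matrix_mat: "h 0 = 0 \<Longrightarrow> map_matrix h (mat c) = mat (h c)"
  by (simp add: vec_eq_iff mat_def)

lemmas map_matrix_at_y0_mult = map_matrix_mult[OF additive_at_y0 at_y0_mult]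
lemmas map_matrix_at_y0_mat = map_matrix_mat[of at_y0, OF Modules.additive.zero[OF additive_at_y0]]

lemma at_y0_1: "at_y0 1 = 1"
  by (simp add: at_y0_def subst_poly_1)

lemma map_matrix_at_y0_mat_prod:
  "map_matrix at_y0 (mat_prod M) = mat_prod (\<lambda>i. map_matrix at_y0 (M i))"
proof -
  have "map_matrix at_y0 (foldr (\<lambda>i B. M i ** B) is (mat 1)) =
      foldr (\<lambda>i B. map_matrix at_y0 (M i) ** B) is (mat 1)" for "is"
    by (induct "is") (simp_all add: map_matrix_at_y0_mult map_matrix_at_y0_mat at_y0_1)
  then show ?thesis by (simp add: mat_prod_def)
qed

lemma sigma_mult_nth: "(sigma ** A) $ r $ s = case_sum (\<lambda>_. 1) (\<lambda>_. - 1) r * A $ r $ s"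
  by (simp add: sigma_def matrix_matrix_mult_def if_distrib[of "\<lambda>x. x * _"] cong: if_cong)

lemma mult_sigma_nth: "(A ** sigma) $ r $ s = A $ r $ s * case_sum (\<lambda>_. 1) (\<lambda>_. - 1) s"
  by (simp add: sigma_def matrix_matrix_mult_def if_distrib[of "\<lambda>x. _ * x"] cong: if_cong)

lemma str_eq_sum:
  "str A = (\<Sum>a\<in>UNIV. A $ Inl a $ Inl a) - (\<Sum>a\<in>UNIV. A $ Inr a $ Inr a)"
  by (simp add: str_def trace_def sum_UNIV_Plus sigma_mult_nth sum_negf)

lemma at_y0_str: "at_y0 (str A) = str (map_matrix at_y0 A)"
  by (simp add: str_eq_sum Modules.additive.diff[OF additive_at_y0]
    Modules.additive.sum[OF additive_at_y0])

lemma map_matrix_off_diag: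
  "h 0 = 0 \<Longrightarrow> map_matrix h (off_diag E J) = off_diag (map_matrix h E) (map_matrix h J)"
  by (simp add: vec_eq_iff off_diag_def split: sum.split)

lemma off_diag_square:
  assumes "E ** J = mat W" and "J ** E = mat W"
  shows "off_diag E J ** off_diag E J = mat W"
proof -
  have "(off_diag E J ** off_diag E J) $ r $ s = mat W $ r $ s" for r s
  proof -
    have "(E ** J) $ a $ b = mat W $ a $ b" "(J ** E) $ a $ b = mat W $ a $ b" for a b
      using assms by simp_all
    then show ?thesis
      by (cases r; cases s) (simp_all add: matrix_matrix_mult_def sum_UNIV_Plus off_diag_def mat_def)
  qed
  then show ?thesis by (simp add: vec_eq_iff)
qed

lemma fermionic_off_diag: "fermionic (off_diag E J)"
  by (simp add: fermionic_def vec_eq_iff sigma_mult_nth mult_sigma_nth)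
    (simp add: off_diag_def split: sum.split)

lemma map_matrix_y_part_mult:
  "map_matrix (y_part k) (A ** B) =
    (\<Sum>l\<le>k. map_matrix (y_part (k - l)) A ** map_matrix (y_part l) B)"
  by (simp add: vec_eq_iff matrix_matrix_mult_def Modules.additive.sum[OF additive_y_part] y_part_mult
    sum.swap[of _ "{..k}"])

lemma map_matrix_pdiff_mult:
  "map_matrix (pdiff i) (A ** B) = map_matrix (pdiff i) A ** B + A ** map_matrix (pdiff i) B"
  by (simp add: vec_eq_iff matrix_matrix_mult_def Modules.additive.sum[OF additive_pdiff] pdiff_mult
    sum.distrib)


section \<open>R-charge and quasi-homogeneity\<close>

text \<open>All factors are exponentials of multiples of one \<open>Ln l\<close>, so no branch
  ambiguity arises. For \<open>l = 0\<close> even the empty product fails, since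
  \<open>0 powr 0 = 0\<close>.\<close>

lemma powr_of_rat_sum:
  fixes l :: complex
  assumes "l \<noteq> 0"
  shows "(\<Prod>i\<in>A. (l powr of_rat (w i)) ^ n i) = l powr of_rat (\<Sum>i\<in>A. of_nat (n i) * w i)"
  using assms
  by (induct A rule: infinite_finite_induct)
    (simp_all add: powr_def of_rat_add of_rat_mult distrib_right exp_add mult.assoc
      flip: exp_of_nat_mult)

text \<open>Rescaling acts diagonally: each monomial is an eigenvector, with eigenvalue
  \<open>l\<close> to the power of its weight.\<close>

lemma lookup_rescale:
  assumes "l \<noteq> 0"
  shows "Poly_Mapping.lookup (rescale w l p) a = l powr of_rat (monom_weight w a) * Poly_Mapping.lookup p a"
proof (induct p rule: cpoly_induct)
  case (monom b c)
  have "(\<Prod>i\<in>UNIV. (Const (l powr of_rat (w i)) * Var i) ^ Poly_Mapping.lookup b i) =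
      Const (\<Prod>i\<in>UNIV. (l powr of_rat (w i)) ^ Poly_Mapping.lookup b i) * Poly_Mapping.single b 1"
    by (simp add: power_mult_distrib prod.distrib prod_Var_power Const_prod Const_power)
  then have "rescale w l (Poly_Mapping.single b c) =
      Const (l powr of_rat (monom_weight w b)) * Poly_Mapping.single b c"
    using assms
    by (simp add: rescale_def subst_poly_single powr_of_rat_sum monom_weight_def Const_def mult_single
        mult.commute[of c])
  then show ?case
    by (simp add: lookup_Const_mult lookup_single when_def)
qed (simp_all add: rescale_def subst_poly_add lookup_add distrib_left)

lemma U_mat_mult_nth: "(U_mat g l ** A) $ r $ s = Const (l powr of_rat (g r)) * A $ r $ s"
  by (simp add: U_mat_def matrix_matrix_mult_def if_distrib[of "\<lambda>x. x * _"] cong: if_cong)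

lemma mult_U_mat_nth: "(A ** U_mat g l) $ r $ s = A $ r $ s * Const (l powr of_rat (g s))"
  by (simp add: U_mat_def matrix_matrix_mult_def if_distrib[of "\<lambda>x. _ * x"] cong: if_cong)

text \<open>Clears the inverse from the R-charge condition, so that both sides are products with
  diagonal matrices and can be compared entrywise.\<close>

lemma mult_U_mat_inv_eq_iff:
  fixes A B :: "'v cpoly ^ 'N::finite ^ 'M::finite"
  assumes "l \<noteq> 0"
  shows "A ** matrix_inv (U_mat g l) = B \<longleftrightarrow> A = B ** U_mat g l"
proof -
  let ?U = "U_mat g l :: 'v cpoly ^ 'N ^ 'N" and ?V = "U_mat (\<lambda>r. - g r) l :: 'v cpoly ^ 'N ^ 'N"
  have *: "l powr of_rat x * l powr of_rat (- x) = 1" "l powr of_rat (- x) * l powr of_rat x = 1" for x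
    using assms by (simp_all add: powr_def of_rat_minus flip: exp_add)
  have "?U ** ?V = mat 1"
    by (simp add: vec_eq_iff U_mat_mult_nth) (simp add: U_mat_def mat_def * flip: Const_mult)
  moreover have "?V ** ?U = mat 1"
    by (simp add: vec_eq_iff U_mat_mult_nth)
      (simp add: U_mat_def mat_def * flip: Const_mult)
  \<comment> \<open>\<open>matrix_inv\<close> is a choice; the diagonal matrix with negated
    exponents witnesses that there is an inverse to choose.\<close>
  ultimately have inv: "?U ** matrix_inv ?U = mat 1 \<and>
      matrix_inv ?U ** ?U = mat 1"
    unfolding matrix_inv_def
    using someI[of "\<lambda>B. ?U ** B = mat 1 \<and> B ** ?U = mat 1" ?V] by simp
  show ?thesis
  proof
    assume "A ** matrix_inv ?U = B"
    then have "B ** ?U = A ** (matrix_inv ?U ** ?U)"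
      by (simp only: matrix_mul_assoc)
    then show "A = B ** ?U" using inv by simp
  next
    assume "A = B ** ?U"
    then have "A ** matrix_inv ?U = B ** (?U ** matrix_inv ?U)"
      by (simp only: matrix_mul_assoc)
    then show "A ** matrix_inv ?U = B" using inv by simp
  qed
qed

text \<open>Comparing coefficients of each monomial in each entry leaves an equality of two powers
  of \<open>l\<close>. Holding for all nonzero \<open>l\<close>, it is an equality of
  exponents.\<close>

lemma R_charge_iff_quasi_homogeneous:
  "R_charge w g R A \<longleftrightarrow> (\<forall>r s. quasi_homogeneous w (g s - g r + R) (A $ r $ s))"
proof -
  \<comment> \<open>A vanishing coefficient imposes no condition; any other one cancels.\<close>
  have cancel: "u * (v * x) = t * x * z \<longleftrightarrow> x \<noteq> 0 \<longrightarrow> u * v = t * z" for u v x t z :: complex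
    by auto
  have "U_mat g l ** map_matrix (rescale w l) A ** matrix_inv (U_mat g l) =
      map_matrix ((*) (Const (l powr of_rat R))) A \<longleftrightarrow>
      (\<forall>r s a. Poly_Mapping.lookup (A $ r $ s) a \<noteq> 0 \<longrightarrow>
        l powr of_rat (g r + monom_weight w a) = l powr of_rat (R + g s))"
    if "l \<noteq> 0" for l :: complex
    unfolding mult_U_mat_inv_eq_iff[OF that] using that
    by (simp add: vec_eq_iff U_mat_mult_nth mult_U_mat_nth poly_mapping_eq_iff fun_eq_iff
        lookup_Const_mult lookup_mult_Const lookup_rescale powr_add of_rat_add cancel)
  then have "R_charge w g R A \<longleftrightarrow> (\<forall>l::complex. l \<noteq> 0 \<longrightarrow>
      (\<forall>r s a. Poly_Mapping.lookup (A $ r $ s) a \<noteq> 0 \<longrightarrow>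
        l powr of_rat (g r + monom_weight w a) = l powr of_rat (R + g s)))"
    unfolding R_charge_def by (intro iff_allI imp_cong refl)
  also have "\<dots> \<longleftrightarrow> (\<forall>r s a. Poly_Mapping.lookup (A $ r $ s) a \<noteq> 0 \<longrightarrow>
      (\<forall>l::complex. l \<noteq> 0 \<longrightarrow> l powr of_rat (g r + monom_weight w a) = l powr of_rat (R + g s)))"
    by iprover
  finally have *: "R_charge w g R A \<longleftrightarrow> \<dots>" .
  have "(\<forall>l::complex. l \<noteq> 0 \<longrightarrow> l powr of_rat x = l powr of_rat y) \<longleftrightarrow> x = y" for x y
  proof
    assume "\<forall>l::complex. l \<noteq> 0 \<longrightarrow> l powr of_rat x = l powr of_rat y"
    \<comment> \<open>The single value \<open>l = exp 1\<close> suffices: its logarithm is 1, and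
      the real exponential is injective.\<close>
    then have "exp 1 powr of_rat x = (exp 1 powr of_rat y :: complex)"
      by simp
    moreover have "(of_rat q :: complex) = of_real (of_rat q)" for q
      by (cases q) (simp add: of_rat_rat)
    ultimately have "exp (of_real (of_rat x)) = (exp (of_real (of_rat y)) :: complex)"
      by (simp add: powr_def)
    then show "x = y"
      by (simp only: exp_of_real of_real_eq_iff exp_inj_iff of_rat_eq_iff)
  qed simp
  moreover have "g r + x = R + g s \<longleftrightarrow> x = g s - g r + R" for r s x
    by auto
  ultimately show ?thesis
    unfolding * quasi_homogeneous_def by (simp add: Ball_def in_keys_iff)
qed

lemma quasi_homogeneous_pdiff:
  assumes "quasi_homogeneous w d p"
  shows "quasi_homogeneous w (d - w i) (pdiff i p)"
  unfolding quasi_homogeneous_def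
proof
  fix b
  assume "b \<in> Poly_Mapping.keys (pdiff i p)"
  \<comment> \<open>A monomial with exponent 0 at \<open>i\<close> is differentiated to coefficient
    0, so a key of the derivative comes from one that contains \<open>i\<close>.\<close>
  then obtain a where a: "a \<in> Poly_Mapping.keys p" "Poly_Mapping.lookup a i \<noteq> 0"
    and b: "b = a - Poly_Mapping.single i 1"
    unfolding pdiff_def by (auto dest!: subsetD[OF keys_sum] split: if_splits)
  have "b + Poly_Mapping.single i 1 = a"
    using a(2) unfolding b by (intro poly_mapping_eqI) (auto simp: lookup_add lookup_minus lookup_single when_def)
  then have "monom_weight w a = monom_weight w b + w i"
    by (auto simp: monom_weight_def lookup_add lookup_single when_def distrib_right sum.distrib
        if_distrib[of of_nat] if_distrib[of "\<lambda>x. x * _"] cong: if_cong)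
  then show "monom_weight w b = d - w i"
    using assms a(1) by (simp add: quasi_homogeneous_def)
qed

lemma quasi_homogeneous_at_y0:
  assumes "quasi_homogeneous (case_sum wx wy) d p"
  shows "quasi_homogeneous wx d (at_y0 p)"
  unfolding quasi_homogeneous_def
proof
  fix b
  assume "b \<in> Poly_Mapping.keys (at_y0 p)"
  then obtain a where a: "a \<in> Poly_Mapping.keys p" "Poly_Mapping.map_key Inr a = 0"
    and b: "b = Poly_Mapping.map_key Inl a"
    unfolding at_y0_eq_coeff_along coeff_along_def
    by (auto dest!: subsetD[OF keys_sum] split: if_splits)
  have "Poly_Mapping.lookup a (Inr j) = 0" for j
    using a(2) by (simp add: poly_mapping_eq_iff fun_eq_iff map_key.rep_eq inj_Inl_Inr)
  then have "monom_weight (case_sum wx wy) a = monom_weight wx b"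
    by (simp add: monom_weight_def sum_UNIV_Plus b map_key.rep_eq inj_Inl_Inr)
  then show "monom_weight wx b = d"
    using assms a(1) by (simp add: quasi_homogeneous_def)
qed

text \<open>The constant term has weight 0, hence \<open>d = 0\<close>; positive weights leave the
  trivial monomial as the only one of weight 0.\<close>

lemma quasi_homogeneous_Const:
  assumes "\<And>i. 0 < w i" and "quasi_homogeneous w d p" and "Poly_Mapping.lookup p 0 \<noteq> 0"
  shows "p = Const (Poly_Mapping.lookup p 0)"
proof (rule poly_mapping_eqI)
  fix a
  have "d = 0"
    using assms(2,3) by (force simp: quasi_homogeneous_def in_keys_iff monom_weight_def)
  have "a = 0" if "Poly_Mapping.lookup p a \<noteq> 0"
  proof -
    have "monom_weight w a = 0"
      using that assms(2) \<open>d = 0\<close> by (simp add: quasi_homogeneous_def in_keys_iff)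
    moreover have "0 \<le> of_nat (Poly_Mapping.lookup a i) * w i" for i
      using assms(1)[of i] by simp
    ultimately have "of_nat (Poly_Mapping.lookup a i) * w i = 0" for i
      unfolding monom_weight_def by (subst (asm) sum_nonneg_eq_0_iff) auto
    then have "Poly_Mapping.lookup a i = 0" for i
      using assms(1)[of i] by (metis mult_eq_0_iff of_nat_eq_0_iff less_irrefl)
    then show ?thesis by (intro poly_mapping_eqI) simp
  qed
  then show "Poly_Mapping.lookup p a = Poly_Mapping.lookup (Const (Poly_Mapping.lookup p 0)) a"
    by (auto simp: Const_def lookup_single when_def)
qed


section \<open>The expansion at zero\<close>

lemma matrix_factorisation_square:
  assumes "matrix_factorisation W Q"
  shows "Q ** Q = mat W"
  using assms off_diag_square unfolding matrix_factorisation_def by blast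

text \<open>The sum in \<open>residue_ext\<close> runs over the exponents \<open>b\<close> occurring
  in \<open>p\<close>; a nonzero coefficient certifies that \<open>b\<close> is among them. For
  other \<open>b\<close> the right-hand side is \<open>residue0 f 0\<close>, about which nothing is
  claimed.\<close>

lemma lookup_residue_ext:
  assumes "Poly_Mapping.lookup (residue_ext u v f p) b \<noteq> 0"
  shows "Poly_Mapping.lookup (residue_ext u v f p) b = residue0 f (coeff_along u v b p)"
  using assms
  by (auto simp: residue_ext_def lookup_sum lookup_single when_def split: if_splits)

lemma at_y0_qdim_numerator:
  "at_y0 (qdim_numerator Q) =
    str (mat_prod (\<lambda>i. map_matrix (pdiff i) (map_matrix at_y0 Q)) **
      mat_prod (\<lambda>j. map_matrix at_y0 (map_matrix (pdiff (Inr j)) Q)))"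
proof -
  have "map_matrix at_y0 (map_matrix (pdiff (Inl i)) Q) = map_matrix (pdiff i) (map_matrix at_y0 Q)"
    for i
    by (simp add: vec_eq_iff at_y0_pdiff)
  then show ?thesis
    by (simp add: qdim_numerator_def at_y0_str map_matrix_at_y0_mult map_matrix_at_y0_mat_prod)
qed

text \<open>
  No residue theory enters: a non-zero constant term of \<open>q_L\<close> can only come from the coefficient
  at \<open>y = 0\<close> of the numerator, so one need not even know that \<open>residue0\<close> is well defined.
\<close>

lemma q_L_eq_kapustin_li:
  assumes "q_L V1 Q = Const c" and "c \<noteq> 0"
  shows "q_L V1 (Q :: ('n::{finite,linorder} + 'm::{finite,linorder}, 'N::finite) smat) =
    Const ((- 1) ^ ((CARD('m) + 1) choose 2) * kapustin_li V1 (map_matrix at_y0 Q)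
      (mat_prod (\<lambda>j. map_matrix at_y0 (map_matrix (pdiff (Inr j)) Q))))"
proof -
  let ?e = "(CARD('m) + 1) choose 2"
  let ?p = "residue_ext Inl Inr (\<lambda>i. pdiff i V1) (qdim_numerator Q)"
  have "q_L V1 Q = Const ((- 1) ^ ?e) * ?p"
    by (simp add: q_L_def Const_power Const_minus)
  then have c: "c = (- 1) ^ ?e * Poly_Mapping.lookup ?p 0"
    unfolding assms(1) by (metis lookup_Const_mult Const_def lookup_single_eq)
  \<comment> \<open>Since \<open>c\<close> is nonzero, so is the constant term of \<open>?p\<close>,
    as \<open>lookup_residue_ext\<close> demands.\<close>
  then have "Poly_Mapping.lookup ?p 0 = residue0 (\<lambda>i. pdiff i V1) (at_y0 (qdim_numerator Q))"
    using assms(2) unfolding at_y0_eq_coeff_along by (intro lookup_residue_ext) auto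
  then show ?thesis
    using c assms(1) by (simp add: at_y0_qdim_numerator kapustin_li_def)
qed

lemma sum_y_part:
  "\<exists>kmax. Q = (\<Sum>k\<le>kmax. map_matrix (y_part k) Q) \<and> (\<forall>k>kmax. map_matrix (y_part k) Q = 0)"
proof -
  \<comment> \<open>The cutoff is the largest y-degree in any entry. If \<open>Q = 0\<close>, then
    \<open>S\<close> is empty and \<open>Max S\<close> is an unspecified number, which does no harm
    because all parts vanish.\<close>
  define S where "S = (\<Union>r\<in>UNIV. \<Union>s\<in>UNIV. y_degree ` Poly_Mapping.keys (Q $ r $ s))"
  have "finite S" by (simp add: S_def)
  then have le: "y_degree a \<le> Max S" if "Poly_Mapping.lookup (Q $ r $ s) a \<noteq> 0" for r s a
    using that \<open>finite S\<close> unfolding S_def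
    by (intro Max_ge UN_I imageI) (auto simp: in_keys_iff)
  show ?thesis
  proof (intro exI conjI allI impI)
    have "Poly_Mapping.lookup (Q $ r $ s) a = (\<Sum>k\<le>Max S. Poly_Mapping.lookup (y_part k (Q $ r $ s)) a)"
      for r s a
      using le[of r s a] by (auto simp: lookup_y_part when_def)
    then show "Q = (\<Sum>k\<le>Max S. map_matrix (y_part k) Q)"
      by (simp add: vec_eq_iff poly_mapping_eq_iff fun_eq_iff lookup_sum)
    show "map_matrix (y_part k) Q = 0" if "k > Max S" for k
      using that le by (force simp: vec_eq_iff poly_mapping_eq_iff fun_eq_iff lookup_y_part when_def)
  qed
qed

theorem proposition3p2:
  fixes V1 :: "'n::{finite,linorder} cpoly"
    and V2 :: "'m::{finite,linorder} cpoly"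
    and wx :: "'n \<Rightarrow> rat" and wy :: "'m \<Rightarrow> rat"
    and g :: "'N::finite + 'N \<Rightarrow> rat"
    and Q :: "('n + 'm, 'N) smat"
    and Q1 :: "('n, 'N) smat"
    and F :: "'m \<Rightarrow> ('n, 'N) smat"
  assumes V1: "potential wx V1"
    and V2: "potential wy V2"
    and Q: "orbifold_equivalence wx wy g V1 V2 Q"
    and Q1: "Q1 = map_matrix at_y0 Q"
    and F: "\<And>j. F j = map_matrix at_y0 (map_matrix (pdiff (Inr j)) Q)"
  shows "graded_mf wx g V1 Q1 \<and>
    (\<forall>j. fermionic_morphism Q1 (F j) \<and> R_charge wx g (1 - wy j) (F j)) \<and>
    q_L V1 Q = Const ((- 1) ^ ((CARD('m) + 1) choose 2) * kapustin_li V1 Q1 (mat_prod F)) \<and>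
    (\<exists>kmax. Q = (\<Sum>k\<le>kmax. map_matrix (y_part k) Q) \<and> (\<forall>k>kmax. map_matrix (y_part k) Q = 0)) \<and>
    map_matrix (y_part 0) Q = map_matrix in_x Q1 \<and>
    map_matrix (y_part 1) Q = (\<Sum>j\<in>UNIV. map_matrix ((*) (Var (Inr j))) (map_matrix in_x (F j))) \<and>
    (\<forall>k\<ge>2.
      map_matrix in_x Q1 ** map_matrix (y_part k) Q + map_matrix (y_part k) Q ** map_matrix in_x Q1
        + (\<Sum>l=1..k - 1. map_matrix (y_part (k - l)) Q ** map_matrix (y_part l) Q)
      = - mat (y_part k (in_y V2)))"
proof -
  have mf: "matrix_factorisation (in_x V1 - in_y V2) Q" and RQ: "R_charge (case_sum wx wy) g 1 Q"
    using Q by (auto simp: orbifold_equivalence_def graded_mf_def)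
  have Q1': "Q1 $ r $ s = at_y0 (Q $ r $ s)" for r s
    by (simp add: Q1)
  note square = matrix_factorisation_square[OF mf]
  have V2': "at_y0 (in_y V2 :: ('n + 'm) cpoly) = 0" "at_y0 (pdiff (Inr j) (in_y V2 :: ('n + 'm) cpoly)) = 0" for j
    using at_y0_in_y_ideal_square[of V2] V2 by (auto simp: potential_def)
  obtain E J where EJ: "Q = off_diag E J" "E ** J = mat (in_x V1 - in_y V2)"
    "J ** E = mat (in_x V1 - in_y V2)"
    using mf by (auto simp: matrix_factorisation_def)
  note zero = Modules.additive.zero[OF additive_at_y0] Modules.additive.zero[OF additive_pdiff]
    Modules.additive.zero[OF additive_y_part]
  note diff = Modules.additive.diff[OF additive_at_y0] Modules.additive.diff[OF additive_pdiff]
    Modules.additive.diff[OF additive_y_part]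
  have quasi: "quasi_homogeneous (case_sum wx wy) (g s - g r + 1) (Q $ r $ s)" for r s
    using RQ by (simp add: R_charge_iff_quasi_homogeneous)

  have "matrix_factorisation V1 Q1"
    unfolding matrix_factorisation_def
  proof (intro conjI exI allI impI)
    show "Q1 = off_diag (map_matrix at_y0 E) (map_matrix at_y0 J)"
      by (simp add: Q1 EJ(1) map_matrix_off_diag zero)
    show "map_matrix at_y0 E ** map_matrix at_y0 J = mat V1"
      "map_matrix at_y0 J ** map_matrix at_y0 E = mat V1"
      by (simp_all add: EJ(2,3) map_matrix_at_y0_mat diff V2' at_y0_in_x flip: map_matrix_at_y0_mult)
    fix r s c
    assume "Q1 $ r $ s = Const c"
    \<comment> \<open>\<open>c\<close> is the constant term of the entry of \<open>Q\<close>. Were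
      it nonzero, quasi-homogeneity would make that whole entry constant, which \<open>Q\<close>
      being a matrix factorisation excludes.\<close>
    then have c: "Poly_Mapping.lookup (Q $ r $ s) 0 = c"
      using lookup_at_y0_0[of "Q $ r $ s"] by (simp add: Q1') (simp add: Const_def)
    have "0 < case_sum wx wy i" for i
      using V1 V2 by (cases i) (simp_all add: potential_def)
    then have "Q $ r $ s = Const c" if "c \<noteq> 0"
      using quasi_homogeneous_Const[OF _ quasi, of r s] c that by simp
    then show "c = 0"
      using mf unfolding matrix_factorisation_def by blast
  qed
  moreover have "R_charge wx g 1 Q1"
    using quasi by (auto simp: R_charge_iff_quasi_homogeneous Q1' intro: quasi_homogeneous_at_y0)
  moreover have "fermionic_morphism Q1 (F j)" for j
    unfolding fermionic_morphism_def
  proof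
    show "fermionic (F j)"
      unfolding F EJ(1) by (simp add: map_matrix_off_diag zero fermionic_off_diag)
    \<comment> \<open>The derivative of the square of \<open>Q\<close>; \<open>V1\<close> is free of
      \<open>y_j\<close> and drops out. The remaining right-hand side vanishes at y = 0.\<close>
    have "map_matrix (pdiff (Inr j)) Q ** Q + Q ** map_matrix (pdiff (Inr j)) Q =
        mat (- pdiff (Inr j) (in_y V2))"
      using arg_cong[OF square, of "map_matrix (pdiff (Inr j))"]
      by (simp add: map_matrix_pdiff_mult map_matrix_mat zero diff pdiff_Inr_in_x)
    from arg_cong[OF this, of "map_matrix at_y0"]
    have "map_matrix at_y0 (map_matrix (pdiff (Inr j)) Q ** Q) +
        map_matrix at_y0 (Q ** map_matrix (pdiff (Inr j)) Q) = 0"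
      by (simp add: map_matrix_at_y0_mat Modules.additive.minus[OF additive_at_y0] V2')
        (simp add: vec_eq_iff at_y0_add)
    then show "Q1 ** F j + F j ** Q1 = 0"
      by (simp add: map_matrix_at_y0_mult Q1 F add.commute)
  qed
  moreover have "R_charge wx g (1 - wy j) (F j)" for j
    using quasi_homogeneous_at_y0[OF quasi_homogeneous_pdiff[OF quasi, of _ _ "Inr j"]]
    by (simp add: R_charge_iff_quasi_homogeneous F algebra_simps)
  moreover have "q_L V1 Q = Const ((- 1) ^ ((CARD('m) + 1) choose 2) * kapustin_li V1 Q1 (mat_prod F))"
  proof -
    have "F = (\<lambda>j. map_matrix at_y0 (map_matrix (pdiff (Inr j)) Q))"
      by (rule ext) (rule F)
    then show ?thesis
      using Q q_L_eq_kapustin_li unfolding orbifold_equivalence_def Q1 by blast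
  qed
  moreover have part_0: "map_matrix (y_part 0) Q = map_matrix in_x Q1"
    by (simp add: vec_eq_iff Q1 in_x_at_y0)
  moreover have "map_matrix (y_part 1) Q =
      (\<Sum>j\<in>UNIV. map_matrix ((*) (Var (Inr j))) (map_matrix in_x (F j)))"
    unfolding vec_eq_iff by (simp add: y_part_1 F flip: One_nat_def)
  moreover have "map_matrix in_x Q1 ** map_matrix (y_part k) Q + map_matrix (y_part k) Q ** map_matrix in_x Q1
      + (\<Sum>l=1..k - 1. map_matrix (y_part (k - l)) Q ** map_matrix (y_part l) Q)
      = - mat (y_part k (in_y V2))" if "k \<ge> 2" for k
  proof -
    let ?f = "\<lambda>l. map_matrix (y_part (k - l)) Q ** map_matrix (y_part l) Q"
    \<comment> \<open>The two end terms \<open>l = 0\<close> and \<open>l = k\<close> form the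
      anticommutator with \<open>Q1\<close>, the part of degree 0.\<close>
    have "{..k} = insert 0 (insert k {1..k - 1})"
      using that by auto
    then have "sum ?f {..k} = ?f 0 + (?f k + sum ?f {1..k - 1})"
      using that by simp
    moreover have "sum ?f {..k} = mat (y_part k (in_x V1 - in_y V2))"
      by (simp add: square map_matrix_mat zero flip: map_matrix_y_part_mult)
    \<comment> \<open>\<open>V1\<close> lives in degree 0 only and \<open>k\<close> is
      positive.\<close>
    moreover have "\<dots> = - mat (y_part k (in_y V2))"
      using that by (simp add: diff y_part_in_x vec_eq_iff mat_def)
    ultimately show ?thesis
      by (simp add: part_0 add_ac)
  qed
  ultimately show ?thesis
    using sum_y_part[of Q] by (simp add: graded_mf_def)
qed

end
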